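(* Let $(\mathcal{X},\rho)$ be a non-empty metric space with Borel $\sigma$-algebra $\mathcal{F}$. For each $d\in\mathbb{N}$ let $X^{(d)}=\{X^{(d)}_t\}_{t\ge 0}$ be a time-homogeneous Markov process on $(\mathcal{X},\mathcal{F})$, and let $X^{(\infty)}=\{X^{(\infty)}_t\}_{t\ge 0}$ be another stochastic process on $(\mathcal{X},\mathcal{F})$. Suppose that $X^{(d)}$ converges weakly in the Skorokhod topology to $X^{(\infty)}$ as $d\to\infty$, i.e. that for each fixed $t\ge 0$ and each starting state $x\in\mathcal{X}$, $\mathcal{L}_x(X^{(d)}_t)\Rightarrow\mathcal{L}_x(X^{(\infty)}_t)$ as $d\to\infty$. Assume that all of the processes $X^{(d)}$ ($d\in\mathbb{N}$) and $X^{(\infty)}$ have the same stationary probability distribution $\pi$, and that $X^{(\infty)}$ converges to $\pi$ (either weakly or in total variation distance), i.e. for each $x\in\mathcal{X}$, $\mathcal{L}_x(X^{(\infty)}_t)\to\pi$ as $t\to\infty$ in that sense. Then for every $\epsilon>0$ there are $D<\infty$ and $T<\infty$ such that $$\mathbf{E}_{X^{(d)}_0\sim\pi}\,\bigl\|\mathcal{L}_{X^{(d)}_0}(X^{(d)}_t)-\pi\bigr\|_{KR}<\epsilon\qquad\text{for all } t\ge T \text{ and all } d\ge D.$$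
   Context: For a process $\{X_t\}$ on $(\mathcal{X},\mathcal{F})$, $\mathcal{L}_x(X_t)$ denotes the law of $X_t$ conditional on starting at $X_0=x$, and $\mathbf{E}_x$ is expectation under this law. A probability distribution $\pi$ is stationary if $X_0\sim\pi$ implies $X_t\sim\pi$ for all $t\ge0$. The symbol $\Rightarrow$ denotes weak convergence of probability measures. Let $\mathrm{Lip}_1^1$ be the set of functions $f:\mathcal{X}\to\mathbb{R}$ with $|f(x)-f(y)|\le\rho(x,y)$ for all $x,y\in\mathcal{X}$ and $|f(x)|\le 1$ for all $x\in\mathcal{X}$. For a signed measure $\mu$ on $(\mathcal{X},\mathcal{F})$, $\|\mu\|_{KR}=\sup_{f\in\mathrm{Lip}_1^1}\int f\,d\mu$; thus $\|\mathcal{L}_x(X_t)-\pi\|_{KR}=\sup_{f\in \mathrm{Lip}_1^1}|\mathbf{E}_x[f(X_t)]-\pi(f)|$ with $\pi(f)=\int f\,d\pi$. The total variation distance is defined in the same way with the supremum taken over all measurable $f:\mathcal{X}\to\mathbb{R}$ with $|f|\le1$. The averaged distance is $$\mathbf{E}_{X_0\sim\pi}\|\mathcal{L}_{X_0}(X_t)-\pi\|_{KR}:=\int_{\mathcal{X}}\pi(dx)\,\|\mathcal{L}_x(X_t)-\pi\|_{KR}.$$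
   Formalization: The formal theorem also assumes that π is concentrated on the closure of a countable set; this is automatic for separable spaces, and for all metric spaces unless real-valued measurable cardinals exist; if one ≤ continuum exists, the claim as stated can fail. *)

theory Defs
  imports "HOL-Probability.Probability"
begin

text \<open>
  A process with time set \<open>[0, \<infinity>)\<close> is given by coordinate maps \<open>X t\<close> on a sample space
  \<open>\<Omega>\<close>, together with the law \<open>P x\<close> on \<open>\<Omega>\<close> of the process conditional on \<open>X\<^sub>0 = x\<close>.
  These conditional laws form a probability kernel, so that the process started from an initial
  distribution \<open>\<mu>\<close> has law \<open>\<mu> \<bind> P\<close>. Nothing is said about \<open>X t\<close> for negative \<open>t\<close>.
\<close>

locale process_family =
  fixes \<Omega> :: "'w measure"
    and X :: "real \<Rightarrow> 'w \<Rightarrow> 'a :: metric_space"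
    and P :: "'a \<Rightarrow> 'w measure"
  assumes kernel: "P \<in> borel \<rightarrow>\<^sub>M prob_algebra \<Omega>"
    and measurable_X: "\<And>t. 0 \<le> t \<Longrightarrow> X t \<in> \<Omega> \<rightarrow>\<^sub>M borel"
    and start: "\<And>x. AE \<omega> in P x. X 0 \<omega> = x"

definition law :: "(real \<Rightarrow> 'w \<Rightarrow> 'a :: metric_space) \<Rightarrow> ('a \<Rightarrow> 'w measure) \<Rightarrow> 'a \<Rightarrow> real \<Rightarrow> 'a measure"
  where "law X P x t = distr (P x) borel (X t)"

definition natural_filtration ::
    "'w measure \<Rightarrow> (real \<Rightarrow> 'w \<Rightarrow> 'a :: metric_space) \<Rightarrow> real \<Rightarrow> 'w measure"
  where "natural_filtration \<Omega> X s =
    sigma (space \<Omega>) {X u -` A \<inter> space \<Omega> | u A. 0 \<le> u \<and> u \<le> s \<and> A \<in> sets borel}"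

text \<open>
  Time-homogeneity: the conditional probability of \<open>X (s + t) \<in> A\<close> given the past up to time \<open>s\<close>
  is the probability of \<open>X t \<in> A\<close> for the same process restarted at \<open>X s\<close>.
\<close>

locale homogeneous_markov_process = process_family +
  assumes markov: "\<And>x s t A. 0 \<le> s \<Longrightarrow> 0 \<le> t \<Longrightarrow> A \<in> sets borel \<Longrightarrow>
    AE \<omega> in P x. real_cond_exp (P x) (natural_filtration \<Omega> X s)
                   (\<lambda>\<omega>'. indicator A (X (s + t) \<omega>')) \<omega>
                 = measure (law X P (X s \<omega>) t) A"

definition stationary ::
    "(real \<Rightarrow> 'w \<Rightarrow> 'a :: metric_space) \<Rightarrow> ('a \<Rightarrow> 'w measure) \<Rightarrow> 'a measure \<Rightarrow> bool"
  where "stationary X P \<pi> \<longleftrightarrow>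
    prob_space \<pi> \<and> sets \<pi> = sets borel \<and> (\<forall>t\<ge>0. distr (\<pi> \<bind> P) borel (X t) = \<pi>)"

definition weakly_tendsto ::
    "('i \<Rightarrow> 'a :: metric_space measure) \<Rightarrow> 'a measure \<Rightarrow> 'i filter \<Rightarrow> bool"
  where "weakly_tendsto \<mu> \<nu> F \<longleftrightarrow>
    (\<forall>f :: 'a \<Rightarrow> real. continuous_on UNIV f \<and> bounded (range f) \<longrightarrow>
       ((\<lambda>i. \<integral>x. f x \<partial>\<mu> i) \<longlongrightarrow> (\<integral>x. f x \<partial>\<nu>)) F)"

text \<open>
  The two distances below are only applied to Borel probability measures, where all integrals
  exist and the supremum is taken over a set of reals bounded by 2.
\<close>

definition Lip11 :: "('a :: metric_space \<Rightarrow> real) set"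
  where "Lip11 = {f. (\<forall>x y. \<bar>f x - f y\<bar> \<le> dist x y) \<and> (\<forall>x. \<bar>f x\<bar> \<le> 1)}"

definition KR_dist :: "'a :: metric_space measure \<Rightarrow> 'a measure \<Rightarrow> real"
  where "KR_dist \<mu> \<nu> = (SUP f\<in>Lip11. \<bar>(\<integral>x. f x \<partial>\<mu>) - (\<integral>x. f x \<partial>\<nu>)\<bar>)"

definition TV_dist :: "'a :: metric_space measure \<Rightarrow> 'a measure \<Rightarrow> real"
  where "TV_dist \<mu> \<nu> =
    (SUP f\<in>{f \<in> borel_measurable borel. \<forall>x. \<bar>f x\<bar> \<le> 1}. \<bar>(\<integral>x. f x \<partial>\<mu>) - (\<integral>x. f x \<partial>\<nu>)\<bar>)"

text \<open>
  The integrand is an uncountable supremum, so it need not be Borel measurable in \<open>x\<close>.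
  If \<open>\<pi>\<close> is stationary and concentrated on a separable set, the integrand agrees \<open>\<pi>\<close>-almost
  everywhere with a Borel function, and the nonnegative integral then has the same value as
  for that function. The Bochner integral would be 0 for a non-measurable integrand.
\<close>

definition averaged_KR_dist ::
    "(real \<Rightarrow> 'w \<Rightarrow> 'a :: metric_space) \<Rightarrow> ('a \<Rightarrow> 'w measure) \<Rightarrow> 'a measure \<Rightarrow> real \<Rightarrow> ennreal"
  where "averaged_KR_dist X P \<pi> t = (\<integral>\<^sup>+x. ennreal (KR_dist (law X P x t) \<pi>) \<partial>\<pi>)"

text \<open>
  Separability of the support of a Borel measure. Every Borel probability measure on a separable
  metric space has this property; that every Borel probability measure on every metric space
  has it is consistent with ZFC, and fails only if real-valued measurable cardinals exist.
\<close>

definition separably_supported :: "'a :: metric_space measure \<Rightarrow> bool"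
  where "separably_supported \<pi> \<longleftrightarrow> (\<exists>S. countable S \<and> (AE x in \<pi>. x \<in> closure S))"

end

theory Submission
  imports Defs
begin

text \<open>
  By convexity of the distance to \<open>\<pi>\<close> and the Markov property,
  \<open>KR_dist (law x (s + t)) \<pi>\<close> is at most the mean of \<open>KR_dist (law y t) \<pi>\<close> over
  \<open>y\<close> distributed as \<open>law x s\<close>. Averaging over \<open>x\<close> distributed as \<open>\<pi>\<close> and using
  stationarity, the averaged distance is nonincreasing in \<open>t\<close>. It therefore suffices to make
  it small at a single time \<open>T\<close>: choose \<open>T\<close> by dominated convergence for the limit process,
  and then \<open>D\<close> by dominated convergence in \<open>d\<close> at that \<open>T\<close>.

  Both limits need that weak convergence to a separably supported limit implies convergence
  in \<open>KR_dist\<close>, and the convexity step needs measurability of the distance in \<open>x\<close>. Both come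
  from the same approximation of \<open>Lip11\<close> by countably many functions, finitely many up to any
  given error.
\<close>

section \<open>Finite approximation of \<open>Lip11\<close> by McShane envelopes\<close>

text \<open>
  The McShane extension of the values \<open>q\<close> on \<open>A\<close>, cut off at 1. For \<open>q = 0\<close> it is the
  truncated distance to \<open>A\<close>, which controls the error of approximating a function in
  \<open>Lip11\<close> by the envelope of its (rounded) values on \<open>A\<close>.
\<close>

definition envelope :: "'a::metric_space set \<Rightarrow> ('a \<Rightarrow> real) \<Rightarrow> 'a \<Rightarrow> real"
  where "envelope A q x = Min (insert 1 ((\<lambda>a. q a + dist x a) ` A))"

lemma envelope_le:
  assumes "finite A"
  shows "envelope A q x \<le> 1" "a \<in> A \<Longrightarrow> envelope A q x \<le> q a + dist x a"
  using assms by (auto simp: envelope_def intro!: Min_le)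

lemma envelope_ge_iff:
  assumes "finite A"
  shows "c \<le> envelope A q x \<longleftrightarrow> c \<le> 1 \<and> (\<forall>a\<in>A. c \<le> q a + dist x a)"
  using assms by (auto simp: envelope_def)

text \<open>A minimum of 1-Lipschitz functions is 1-Lipschitz. The cut-off gives the upper bound 1,
  and \<open>q a \<ge> -1\<close> with nonnegative distances gives the lower bound.\<close>

lemma envelope_in_Lip11:
  assumes A: "finite A" and q: "\<And>a. a \<in> A \<Longrightarrow> -1 \<le> q a"
  shows "envelope A q \<in> Lip11"
proof -
  have le: "envelope A q x - dist x y \<le> envelope A q y" for x y
  proof -
    have "envelope A q x - dist x y \<le> q a + dist y a" if "a \<in> A" for a
      using envelope_le(2)[OF A that, of q x] dist_triangle[of x a y] by linarith
    then show ?thesis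
      using envelope_le(1)[OF A, of q x] by (subst envelope_ge_iff[OF A]) (auto simp: algebra_simps add_increasing2)
  qed
  have "\<bar>envelope A q x - envelope A q y\<bar> \<le> dist x y" for x y
    using le[of x y] le[of y x] by (simp add: dist_commute)
  moreover have "-1 \<le> envelope A q x" for x
    using q by (subst envelope_ge_iff[OF A]) (force intro: add_increasing2)
  ultimately show ?thesis
    using envelope_le(1)[OF A] by (auto simp: Lip11_def abs_le_iff minus_le_iff)
qed

text \<open>The step is 1 / (k + 1), so that it makes sense for \<open>k = 0\<close> as
  well.\<close>

definition grid :: "nat \<Rightarrow> real set"
  where "grid k = (\<lambda>i. real_of_int i / real (Suc k)) ` {- int (Suc k)..int (Suc k)}"

lemma finite_grid: "finite (grid k)"
  by (simp add: grid_def)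

lemma grid_ge: "r \<in> grid k \<Longrightarrow> -1 \<le> r"
  by (auto simp: grid_def field_simps)

text \<open>Rounding is downward, so that in \<open>grid_envelopes_approx\<close> only the lower
  bound on the envelope carries the grid error.\<close>

lemma grid_approx:
  fixes r :: real
  assumes "\<bar>r\<bar> \<le> 1"
  obtains p where "p \<in> grid k" "p \<le> r" "r \<le> p + 1 / Suc k"
proof
  let ?i = "\<lfloor>r * Suc k\<rfloor>"
  have "\<bar>r\<bar> * real (Suc k) \<le> 1 * real (Suc k)"
    using assms by (intro mult_right_mono) auto
  then have "\<bar>r * real (Suc k)\<bar> \<le> real (Suc k)"
    by (simp add: abs_mult)
  then have "- int (Suc k) \<le> ?i" "?i \<le> int (Suc k)"
    by (auto simp: le_floor_iff floor_le_iff)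
  then show "real_of_int ?i / Suc k \<in> grid k"
    by (auto simp: grid_def)
  have i: "real_of_int ?i \<le> r * Suc k" "r * Suc k \<le> real_of_int ?i + 1"
    by linarith+
  show "real_of_int ?i / Suc k \<le> r"
    using i(1) by (subst pos_divide_le_eq) auto
  have "r \<le> (real_of_int ?i + 1) / Suc k"
    using i(2) by (subst pos_le_divide_eq) auto
  then show "r \<le> real_of_int ?i / Suc k + 1 / Suc k"
    by (simp add: add_divide_distrib)
qed

text \<open>\<open>envelope A q\<close> reads \<open>q\<close> only on \<open>A\<close>; the
  extensional function space keeps the index set, and hence the class, finite for finite
  \<open>A\<close>.\<close>

definition grid_envelopes :: "'a::metric_space set \<Rightarrow> nat \<Rightarrow> ('a \<Rightarrow> real) set"
  where "grid_envelopes A k = envelope A ` (A \<rightarrow>\<^sub>E grid k)"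

lemma finite_grid_envelopes: "finite A \<Longrightarrow> finite (grid_envelopes A k)"
  by (simp add: grid_envelopes_def finite_PiE finite_grid)

lemma grid_envelopes_subset: "finite A \<Longrightarrow> grid_envelopes A k \<subseteq> Lip11"
  by (auto simp: grid_envelopes_def PiE_def Pi_def intro!: envelope_in_Lip11 grid_ge)

lemma envelope_zero_bounds:
  assumes "finite A"
  shows "envelope A (\<lambda>_. 0) \<in> Lip11" "0 \<le> envelope A (\<lambda>_. 0) x" "envelope A (\<lambda>_. 0) x \<le> 1"
  using envelope_in_Lip11[of A "\<lambda>_. 0"] envelope_ge_iff[of A 0 "\<lambda>_. 0" x] envelope_le(1)[of A "\<lambda>_. 0" x] assms
  by auto

text \<open>Take for \<open>g\<close> the envelope of the values of \<open>f\<close> on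
  \<open>A\<close>, rounded down to the grid. As \<open>f x\<close> is at most
  \<open>f a + dist x a\<close>, \<open>g\<close> falls below \<open>f\<close> by at most the grid
  step. Conversely \<open>g x\<close> is at most \<open>f a + dist x a\<close>, hence at most
  \<open>f x + 2 * dist x a\<close>.\<close>

lemma grid_envelopes_approx:
  assumes f: "f \<in> Lip11" and A: "finite A"
  obtains g where "g \<in> grid_envelopes A k"
    "\<And>x. \<bar>f x - g x\<bar> \<le> 1 / Suc k + 2 * envelope A (\<lambda>_. 0) x"
proof -
  have lip: "\<bar>f x - f y\<bar> \<le> dist x y" and bd: "\<bar>f x\<bar> \<le> 1" for x y
    using f by (auto simp: Lip11_def)
  define r where "r = 1 / real (Suc k)"
  have r: "0 \<le> r"
    by (simp add: r_def)
  have "\<exists>p. p \<in> grid k \<and> p \<le> f a \<and> f a \<le> p + r" for a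
    using grid_approx[OF bd[of a], of k] unfolding r_def by metis
  then obtain p where p: "\<And>a. p a \<in> grid k" "\<And>a. p a \<le> f a" "\<And>a. f a \<le> p a + r"
    by metis
  define q where "q = restrict p A"
  let ?g = "envelope A q" and ?h = "envelope A (\<lambda>_. 0)"
  have "\<bar>f x - ?g x\<bar> \<le> r + 2 * ?h x" for x
  proof -
    have "f x - r \<le> q a + dist x a" if "a \<in> A" for a
      using that p(3)[of a] lip[of x a] by (auto simp: q_def)
    moreover have "f x - r \<le> 1"
      using bd[of x] r by linarith
    ultimately have lower: "f x - r \<le> ?g x"
      by (subst envelope_ge_iff[OF A]) auto
    \<comment> \<open>Halving gives the form that \<open>envelope_ge_iff\<close> asks for; the
      cut-off 1 in \<open>?h\<close> then corresponds to the trivial bound 2 on the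
      difference.\<close>
    have "(?g x - f x) / 2 \<le> 0 + dist x a" if "a \<in> A" for a
      using envelope_le(2)[OF A that, of q x] that p(2)[of a] lip[of x a] by (auto simp: q_def)
    moreover have "(?g x - f x) / 2 \<le> 1"
      using bd[of x] envelope_le(1)[OF A, of q x] by (auto simp: abs_le_iff)
    ultimately have "(?g x - f x) / 2 \<le> ?h x"
      by (subst envelope_ge_iff[OF A]) auto
    then have "?g x - f x \<le> 2 * ?h x"
      by simp
    then show ?thesis
      using lower r envelope_zero_bounds(2)[OF A, of x] by linarith
  qed
  moreover have "?g \<in> grid_envelopes A k"
    using p(1) by (auto simp: grid_envelopes_def q_def)
  ultimately show thesis
    using that unfolding r_def by blast
qed

section \<open>Integrals of \<open>Lip11\<close> functions and distances over subclasses\<close>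

lemma Lip11_continuous:
  assumes "f \<in> Lip11"
  shows "continuous_on UNIV f"
proof -
  have "1-lipschitz_on UNIV f"
    using assms by (intro lipschitz_onI) (auto simp: Lip11_def dist_real_def)
  then show ?thesis
    by (rule lipschitz_on_continuous_on)
qed

lemma Lip11_measurable: "f \<in> Lip11 \<Longrightarrow> f \<in> borel_measurable borel"
  by (intro borel_measurable_continuous_onI Lip11_continuous)

lemma Lip11_measurable_on:
  "f \<in> Lip11 \<Longrightarrow> \<mu> \<in> space (prob_algebra borel) \<Longrightarrow> f \<in> borel_measurable \<mu>"
  using Lip11_measurable by (auto simp: space_prob_algebra cong: measurable_cong_sets)

lemma Lip11_integrable:
  assumes f: "f \<in> Lip11" and \<mu>: "\<mu> \<in> space (prob_algebra borel)"
  shows "integrable \<mu> f"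
proof -
  interpret prob_space \<mu>
    using \<mu> by (simp add: space_prob_algebra)
  show ?thesis
    using f by (intro integrable_const_bound[of _ 1] Lip11_measurable_on[OF f \<mu>]) (auto simp: Lip11_def)
qed

text \<open>A non-integrable \<open>f\<close> has Bochner integral 0 by convention, so the bound
  holds there too and the suprema below are bounded without measurability side conditions.\<close>

lemma bounded_integral_le_1:
  fixes f :: "'a \<Rightarrow> real"
  assumes \<mu>: "prob_space \<mu>" and f: "\<And>x. \<bar>f x\<bar> \<le> 1"
  shows "\<bar>\<integral>x. f x \<partial>\<mu>\<bar> \<le> 1"
proof (cases "integrable \<mu> f")
  case True
  interpret prob_space \<mu> by fact
  have "\<bar>\<integral>x. f x \<partial>\<mu>\<bar> \<le> (\<integral>x. \<bar>f x\<bar> \<partial>\<mu>)"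
    by simp
  also have "\<dots> \<le> (\<integral>x. 1 \<partial>\<mu>)"
    using True f by (intro integral_mono) auto
  finally show ?thesis
    by (simp add: prob_space)
qed (simp add: not_integrable_integral_eq)

text \<open>A variable class lets the same lemmas serve \<open>Lip11\<close> and the countable
  \<open>test_functions\<close>; over a countable class the distance is measurable along a
  kernel.\<close>

definition KR_dist_on :: "('a::metric_space \<Rightarrow> real) set \<Rightarrow> 'a measure \<Rightarrow> 'a measure \<Rightarrow> real"
  where "KR_dist_on G \<mu> \<nu> = (SUP f\<in>G. \<bar>(\<integral>x. f x \<partial>\<mu>) - (\<integral>x. f x \<partial>\<nu>)\<bar>)"

lemma KR_dist_eq: "KR_dist = KR_dist_on Lip11"
  by (intro ext) (simp add: KR_dist_def KR_dist_on_def)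

lemma zero_in_Lip11: "(\<lambda>_. 0) \<in> Lip11"
  by (simp add: Lip11_def)

lemma Lip11_nonempty: "Lip11 \<noteq> {}"
  using zero_in_Lip11 by blast

lemma integral_diff_le_2:
  fixes f :: "'a \<Rightarrow> real"
  assumes "prob_space \<mu>" "prob_space \<nu>" "\<And>x. \<bar>f x\<bar> \<le> 1"
  shows "\<bar>(\<integral>x. f x \<partial>\<mu>) - (\<integral>x. f x \<partial>\<nu>)\<bar> \<le> 2"
  using bounded_integral_le_1[of \<mu> f, OF assms(1,3)] bounded_integral_le_1[of \<nu> f, OF assms(2,3)]
  by linarith

lemma KR_dist_on_bdd:
  assumes "G \<subseteq> Lip11" "prob_space \<mu>" "prob_space \<nu>"
  shows "bdd_above ((\<lambda>f. \<bar>(\<integral>x. f x \<partial>\<mu>) - (\<integral>x. f x \<partial>\<nu>)\<bar>) ` G)"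
  using assms by (intro bdd_aboveI2[of _ _ 2] integral_diff_le_2) (auto simp: Lip11_def)

lemma KR_dist_on_upper:
  assumes "G \<subseteq> Lip11" "prob_space \<mu>" "prob_space \<nu>" "f \<in> G"
  shows "\<bar>(\<integral>x. f x \<partial>\<mu>) - (\<integral>x. f x \<partial>\<nu>)\<bar> \<le> KR_dist_on G \<mu> \<nu>"
  unfolding KR_dist_on_def using assms by (intro cSUP_upper KR_dist_on_bdd)

lemma KR_dist_on_bounds:
  assumes "G \<subseteq> Lip11" "G \<noteq> {}" "prob_space \<mu>" "prob_space \<nu>"
  shows "0 \<le> KR_dist_on G \<mu> \<nu>" "KR_dist_on G \<mu> \<nu> \<le> 2"
proof -
  obtain g where "g \<in> G" using assms(2) by blast
  from KR_dist_on_upper[OF assms(1,3,4) this] show "0 \<le> KR_dist_on G \<mu> \<nu>"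
    by linarith
  show "KR_dist_on G \<mu> \<nu> \<le> 2"
    unfolding KR_dist_on_def using assms
    by (intro cSUP_least integral_diff_le_2) (auto simp: Lip11_def)
qed

lemma KR_dist_on_mono:
  assumes "G \<subseteq> H" "H \<subseteq> Lip11" "G \<noteq> {}" "prob_space \<mu>" "prob_space \<nu>"
  shows "KR_dist_on G \<mu> \<nu> \<le> KR_dist_on H \<mu> \<nu>"
  unfolding KR_dist_on_def using assms by (intro cSUP_subset_mono KR_dist_on_bdd) auto

text \<open>A reverse triangle inequality. It turns convergence of laws in \<open>KR_dist\<close>
  into convergence of their distances to a fixed measure.\<close>

lemma KR_dist_on_diff_le:
  assumes G: "G \<subseteq> Lip11" "G \<noteq> {}" and p: "prob_space \<mu>" "prob_space \<nu>" "prob_space \<rho>"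
  shows "\<bar>KR_dist_on G \<mu> \<rho> - KR_dist_on G \<nu> \<rho>\<bar> \<le> KR_dist \<mu> \<nu>"
proof -
  have *: "KR_dist_on G \<mu> \<rho> \<le> KR_dist \<mu> \<nu> + KR_dist_on G \<nu> \<rho>"
    if p: "prob_space \<mu>" "prob_space \<nu>" for \<mu> \<nu>
  proof (subst (1) KR_dist_on_def, intro cSUP_least G(2))
    fix f assume f: "f \<in> G"
    show "\<bar>(\<integral>x. f x \<partial>\<mu>) - (\<integral>x. f x \<partial>\<rho>)\<bar> \<le> KR_dist \<mu> \<nu> + KR_dist_on G \<nu> \<rho>"
      using KR_dist_on_upper[OF G(1) p(2) assms(5) f] KR_dist_on_upper[OF subset_refl p, of f] f G(1)
      by (auto simp: KR_dist_eq)
  qed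
  have "KR_dist \<nu> \<mu> = KR_dist \<mu> \<nu>"
    by (simp add: KR_dist_def abs_minus_commute)
  then show ?thesis
    using *[OF p(1,2)] *[OF p(2,1)] by linarith
qed

text \<open>Functions in \<open>Lip11\<close> are continuous, hence Borel, so the right-hand
  supremum runs over a larger class.\<close>

lemma KR_dist_le_TV_dist:
  fixes \<mu> \<nu> :: "'a::metric_space measure"
  assumes "prob_space \<mu>" "prob_space \<nu>"
  shows "KR_dist \<mu> \<nu> \<le> TV_dist \<mu> \<nu>"
  unfolding KR_dist_def TV_dist_def
proof (rule cSUP_subset_mono)
  show "bdd_above ((\<lambda>f :: 'a \<Rightarrow> real. \<bar>(\<integral>x. f x \<partial>\<mu>) - (\<integral>x. f x \<partial>\<nu>)\<bar>) `
          {f \<in> borel_measurable borel. \<forall>x. \<bar>f x\<bar> \<le> 1})"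
  proof (rule bdd_aboveI2)
    fix f :: "'a \<Rightarrow> real" assume "f \<in> {f \<in> borel_measurable borel. \<forall>x. \<bar>f x\<bar> \<le> 1}"
    then show "\<bar>(\<integral>x. f x \<partial>\<mu>) - (\<integral>x. f x \<partial>\<nu>)\<bar> \<le> 2"
      by (intro integral_diff_le_2 assms) simp
  qed
next
  show "Lip11 \<subseteq> {f :: 'a \<Rightarrow> real. f \<in> borel_measurable borel \<and> (\<forall>x. \<bar>f x\<bar> \<le> 1)}"
    using Lip11_measurable by (auto simp: Lip11_def)
qed (simp_all add: Lip11_nonempty)

section \<open>Weak convergence implies convergence in \<open>KR_dist\<close>\<close>

lemma grid_envelopes_nonempty: "finite A \<Longrightarrow> grid_envelopes A k \<noteq> {}"
  using grid_envelopes_approx[OF zero_in_Lip11] by (metis empty_iff)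

text \<open>Replacing \<open>f\<close> by its grid envelope costs the grid step plus twice the mean
  truncated distance to \<open>A\<close>, once under each measure. The bound is uniform in
  \<open>f\<close> although only the functions in \<open>grid_envelopes A k\<close> are
  tested.\<close>

lemma Lip11_integral_diff_le:
  assumes f: "f \<in> Lip11" and A: "finite A"
    and \<mu>: "\<mu> \<in> space (prob_algebra borel)" and \<nu>: "\<nu> \<in> space (prob_algebra borel)"
    and e: "\<And>g. g \<in> grid_envelopes A k \<Longrightarrow> \<bar>(\<integral>x. g x \<partial>\<mu>) - (\<integral>x. g x \<partial>\<nu>)\<bar> \<le> e"
  shows "\<bar>(\<integral>x. f x \<partial>\<mu>) - (\<integral>x. f x \<partial>\<nu>)\<bar> \<le>
    e + 2 / Suc k + 2 * (\<integral>x. envelope A (\<lambda>_. 0) x \<partial>\<mu>) + 2 * (\<integral>x. envelope A (\<lambda>_. 0) x \<partial>\<nu>)"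
proof -
  let ?h = "envelope A (\<lambda>_. 0)"
  obtain g where g: "g \<in> grid_envelopes A k" "\<And>x. \<bar>f x - g x\<bar> \<le> 1 / Suc k + 2 * ?h x"
    using grid_envelopes_approx[OF f A, of k] by blast
  have g_Lip: "g \<in> Lip11"
    using g(1) grid_envelopes_subset[OF A] by blast
  have "\<bar>(\<integral>x. f x \<partial>\<rho>) - (\<integral>x. g x \<partial>\<rho>)\<bar> \<le> 1 / Suc k + 2 * (\<integral>x. ?h x \<partial>\<rho>)"
    if \<rho>: "\<rho> \<in> space (prob_algebra borel)" for \<rho>
  proof -
    interpret prob_space \<rho>
      using \<rho> by (simp add: space_prob_algebra)
    note int = Lip11_integrable[OF f \<rho>] Lip11_integrable[OF g_Lip \<rho>]
      Lip11_integrable[OF envelope_zero_bounds(1)[OF A] \<rho>]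
    have "\<bar>(\<integral>x. f x \<partial>\<rho>) - (\<integral>x. g x \<partial>\<rho>)\<bar> = \<bar>\<integral>x. f x - g x \<partial>\<rho>\<bar>"
      using int by simp
    also have "\<dots> \<le> (\<integral>x. \<bar>f x - g x\<bar> \<partial>\<rho>)"
      by simp
    also have "\<dots> \<le> (\<integral>x. 1 / Suc k + 2 * ?h x \<partial>\<rho>)"
      using int g(2) by (intro integral_mono) auto
    also have "\<dots> = 1 / Suc k + 2 * (\<integral>x. ?h x \<partial>\<rho>)"
      using int by (simp add: prob_space)
    finally show ?thesis .
  qed
  from this[OF \<mu>] this[OF \<nu>] e[OF g(1)] show ?thesis
    by (auto simp: abs_le_iff)
qed

text \<open>The truncated distance to the first points of \<open>s\<close> tends to 0 on the closure
  of the range and is dominated by 1.\<close>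

lemma integral_envelope_zero_tendsto:
  fixes s :: "nat \<Rightarrow> 'a::metric_space"
  assumes \<nu>: "\<nu> \<in> space (prob_algebra borel)" and s: "AE x in \<nu>. x \<in> closure (range s)"
  shows "(\<lambda>n. \<integral>x. envelope (s ` {..n}) (\<lambda>_. 0) x \<partial>\<nu>) \<longlonglongrightarrow> 0"
proof -
  interpret prob_space \<nu>
    using \<nu> by (simp add: space_prob_algebra)
  let ?h = "\<lambda>n. envelope (s ` {..n}) (\<lambda>_. 0)"
  have h: "?h n \<in> Lip11" "0 \<le> ?h n x" "?h n x \<le> 1" for n x
    by (intro envelope_zero_bounds finite_imageI finite_atMost)+
  have "(\<lambda>n. \<integral>x. ?h n x \<partial>\<nu>) \<longlonglongrightarrow> (\<integral>x. 0 \<partial>\<nu>)"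
  proof (rule integral_dominated_convergence[where w = "\<lambda>_. 1"])
    show "AE x in \<nu>. (\<lambda>n. ?h n x) \<longlonglongrightarrow> 0"
      using s
    proof eventually_elim
      case (elim x)
      show ?case
      proof (rule LIMSEQ_I)
        fix e :: real assume "e > 0"
        then obtain m where m: "dist (s m) x < e"
          using elim by (auto simp: closure_approachable)
        have "norm (?h n x - 0) < e" if "n \<ge> m" for n
        proof -
          have "?h n x \<le> 0 + dist x (s m)"
            using that by (intro envelope_le) auto
          then show ?thesis
            using m h(2)[of n x] by (simp add: dist_commute)
        qed
        then show "\<exists>N. \<forall>n\<ge>N. norm (?h n x - 0) < e"
          by blast
      qed
    qed
  qed (use h in \<open>auto intro: Lip11_measurable_on[OF _ \<nu>]\<close>)
  then show ?thesis by simp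
qed

lemma weakly_tendsto_Lip11:
  assumes "weakly_tendsto \<mu> \<nu> F" "f \<in> Lip11"
  shows "((\<lambda>i. \<integral>x. f x \<partial>\<mu> i) \<longlongrightarrow> (\<integral>x. f x \<partial>\<nu>)) F"
proof -
  have "bounded (range f)"
    using assms(2) by (auto simp: Lip11_def bounded_iff)
  then show ?thesis
    using assms Lip11_continuous unfolding weakly_tendsto_def by blast
qed

text \<open>Separability is required of the limit only: the truncated distance \<open>?h\<close> is
  itself in \<open>Lip11\<close>, so weak convergence carries the smallness of its integral from
  \<open>\<nu>\<close> to \<open>\<mu> i\<close>. Finitely many test functions then suffice for the
  given error.\<close>

lemma weakly_tendsto_imp_KR_dist_tendsto:
  fixes \<mu> :: "'i \<Rightarrow> 'a::metric_space measure" and s :: "nat \<Rightarrow> 'a"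
  assumes w: "weakly_tendsto \<mu> \<nu> F"
    and \<mu>: "eventually (\<lambda>i. \<mu> i \<in> space (prob_algebra borel)) F"
    and \<nu>: "\<nu> \<in> space (prob_algebra borel)" and s: "AE x in \<nu>. x \<in> closure (range s)"
  shows "((\<lambda>i. KR_dist (\<mu> i) \<nu>) \<longlongrightarrow> 0) F"
proof (rule tendstoI)
  fix e :: real assume e: "e > 0"
  \<comment> \<open>The four error terms in \<open>Lip11_integral_diff_le\<close> will be at most
    \<open>e / 8\<close>, \<open>e / 8\<close>, \<open>2 * (e / 16 + e / 8)\<close> and
    \<open>2 * (e / 16)\<close>. They add up to \<open>3 / 4 * e\<close>, which keeps the inequality
    strict after the supremum.\<close>
  obtain k where "inverse (real (Suc k)) < e / 16"
    using reals_Archimedean[of "e / 16"] e by auto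
  then have k: "2 / real (Suc k) < e / 8"
    by (simp add: field_simps)
  have "eventually (\<lambda>n. (\<integral>x. envelope (s ` {..n}) (\<lambda>_. 0) x \<partial>\<nu>) < e / 16) sequentially"
    using integral_envelope_zero_tendsto[OF \<nu> s] e by (intro order_tendstoD) auto
  then obtain n where n: "(\<integral>x. envelope (s ` {..n}) (\<lambda>_. 0) x \<partial>\<nu>) < e / 16"
    by (auto simp: eventually_sequentially)
  let ?A = "s ` {..n}"
  let ?h = "envelope ?A (\<lambda>_. 0)"
  have A: "finite ?A" by simp
  let ?E = "insert ?h (grid_envelopes ?A k)"
  have ev: "eventually (\<lambda>i. \<bar>(\<integral>x. g x \<partial>\<mu> i) - (\<integral>x. g x \<partial>\<nu>)\<bar> < e / 8) F" if "g \<in> ?E" for g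
    using tendstoD[OF weakly_tendsto_Lip11[OF w, of g], of "e / 8"] that e
      grid_envelopes_subset[OF A] envelope_zero_bounds(1)[OF A] by (auto simp: dist_real_def)
  have "eventually (\<lambda>i. \<forall>g\<in>?E. \<bar>(\<integral>x. g x \<partial>\<mu> i) - (\<integral>x. g x \<partial>\<nu>)\<bar> < e / 8) F"
    using ev finite_grid_envelopes[OF A] by (intro eventually_ball_finite) auto
  then show "eventually (\<lambda>i. dist (KR_dist (\<mu> i) \<nu>) 0 < e) F"
    using \<mu>
  proof eventually_elim
    case (elim i)
    have "KR_dist (\<mu> i) \<nu> \<le> 3 / 4 * e"
      unfolding KR_dist_def
    proof (rule cSUP_least)
      fix f :: "'a \<Rightarrow> real" assume f: "f \<in> Lip11"
      have "\<bar>(\<integral>x. f x \<partial>\<mu> i) - (\<integral>x. f x \<partial>\<nu>)\<bar> \<le>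
        e / 8 + 2 / Suc k + 2 * (\<integral>x. ?h x \<partial>\<mu> i) + 2 * (\<integral>x. ?h x \<partial>\<nu>)"
        using elim by (intro Lip11_integral_diff_le[OF f A _ \<nu>]) (auto intro: less_imp_le)
      moreover have "\<bar>(\<integral>x. ?h x \<partial>\<mu> i) - (\<integral>x. ?h x \<partial>\<nu>)\<bar> < e / 8"
        using elim by simp
      ultimately show "\<bar>(\<integral>x. f x \<partial>\<mu> i) - (\<integral>x. f x \<partial>\<nu>)\<bar> \<le> 3 / 4 * e"
        using n k by linarith
    qed (rule Lip11_nonempty)
    moreover have "0 \<le> KR_dist (\<mu> i) \<nu>"
      using elim \<nu> unfolding KR_dist_eq
      by (intro KR_dist_on_bounds Lip11_nonempty) (auto simp: space_prob_algebra)
    ultimately show ?case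
      using e by simp
  qed
qed

section \<open>Reduction of the supremum to a countable class\<close>

definition test_functions :: "(nat \<Rightarrow> 'a::metric_space) \<Rightarrow> ('a \<Rightarrow> real) set"
  where "test_functions s = (\<Union>n k. grid_envelopes (s ` {..n}) k)"

lemma countable_test_functions: "countable (test_functions s)"
  by (simp add: test_functions_def countable_finite finite_grid_envelopes)

lemma test_functions_subset: "test_functions s \<subseteq> Lip11"
  unfolding test_functions_def by (intro UN_least grid_envelopes_subset) auto

lemma test_functions_nonempty: "test_functions s \<noteq> {}"
  by (simp add: test_functions_def grid_envelopes_nonempty)

text \<open>In \<open>Lip11_integral_diff_le\<close> the supremum over
  \<open>test_functions s\<close> can serve as \<open>e\<close> for every finite segment of
  \<open>s\<close> and every grid. Refining both makes the remaining terms vanish, since both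
  measures live on the closure of the range.\<close>

lemma KR_dist_eq_test_functions:
  fixes s :: "nat \<Rightarrow> 'a::metric_space"
  assumes \<mu>: "\<mu> \<in> space (prob_algebra borel)" and \<nu>: "\<nu> \<in> space (prob_algebra borel)"
    and s: "AE x in \<mu>. x \<in> closure (range s)" "AE x in \<nu>. x \<in> closure (range s)"
  shows "KR_dist \<mu> \<nu> = KR_dist_on (test_functions s) \<mu> \<nu>"
proof (rule antisym)
  have p: "prob_space \<mu>" "prob_space \<nu>"
    using \<mu> \<nu> by (auto simp: space_prob_algebra)
  show "KR_dist_on (test_functions s) \<mu> \<nu> \<le> KR_dist \<mu> \<nu>"
    using p test_functions_subset test_functions_nonempty unfolding KR_dist_eq
    by (intro KR_dist_on_mono) auto
  show "KR_dist \<mu> \<nu> \<le> KR_dist_on (test_functions s) \<mu> \<nu>" (is "_ \<le> ?K")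
    unfolding KR_dist_def
  proof (rule cSUP_least)
    fix f :: "'a \<Rightarrow> real" assume f: "f \<in> Lip11"
    let ?I = "\<lambda>\<rho> n. \<integral>x. envelope (s ` {..n}) (\<lambda>_. 0) x \<partial>\<rho>"
    have "(\<lambda>n. ?K + 2 / real (Suc n) + 2 * ?I \<mu> n + 2 * ?I \<nu> n) \<longlonglongrightarrow> ?K + 0 + 2 * 0 + 2 * 0"
      by (intro tendsto_intros integral_envelope_zero_tendsto \<mu> \<nu> s)
        (intro real_tendsto_divide_at_top[OF tendsto_const] filterlim_compose[OF filterlim_real_sequentially] filterlim_Suc)
    moreover have "\<bar>(\<integral>x. f x \<partial>\<mu>) - (\<integral>x. f x \<partial>\<nu>)\<bar> \<le> ?K + 2 / real (Suc n) + 2 * ?I \<mu> n + 2 * ?I \<nu> n" for n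
      by (intro Lip11_integral_diff_le[OF f _ \<mu> \<nu>] KR_dist_on_upper[OF test_functions_subset p])
        (auto simp: test_functions_def)
    ultimately show "\<bar>(\<integral>x. f x \<partial>\<mu>) - (\<integral>x. f x \<partial>\<nu>)\<bar> \<le> ?K"
      by (intro LIMSEQ_le_const) auto
  qed (rule Lip11_nonempty)
qed


section \<open>Measurability and convexity of the distance\<close>

lemma borel_measurable_KR_dist_on:
  assumes G: "countable G" "G \<subseteq> Lip11" and K: "K \<in> M \<rightarrow>\<^sub>M prob_algebra borel" and \<nu>: "prob_space \<nu>"
  shows "(\<lambda>y. KR_dist_on G (K y) \<nu>) \<in> borel_measurable M"
  unfolding KR_dist_on_def
proof (rule borel_measurable_cSUP[OF G(1)])
  fix f assume "f \<in> G"
  then have [measurable]: "f \<in> borel_measurable borel"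
    using G(2) Lip11_measurable by blast
  have [measurable]: "K \<in> M \<rightarrow>\<^sub>M subprob_algebra borel"
    using K by (rule measurable_prob_algebraD)
  have [measurable]: "(\<lambda>y. \<integral>x. f x \<partial>K y) \<in> borel_measurable M"
    by (rule measurable_compose[OF _ integral_measurable_subprob_algebra]) measurable
  show "(\<lambda>y. \<bar>(\<integral>x. f x \<partial>K y) - (\<integral>x. f x \<partial>\<nu>)\<bar>) \<in> borel_measurable M"
    by measurable
next
  fix y assume "y \<in> space M"
  then show "bdd_above ((\<lambda>f. \<bar>(\<integral>x. f x \<partial>K y) - (\<integral>x. f x \<partial>\<nu>)\<bar>) ` G)"
    using measurable_space[OF K] by (intro KR_dist_on_bdd[OF G(2) _ \<nu>]) (auto simp: space_prob_algebra)
qed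

text \<open>The integral of \<open>f\<close> under the mixture is the mean of its integrals under
  \<open>K y\<close>; the absolute value of a mean is at most the mean of the absolute values, and
  each of these is at most the supremum over \<open>G\<close>.\<close>

lemma KR_dist_on_bind_le:
  fixes \<mu> \<nu> :: "'a::metric_space measure"
  assumes G: "countable G" "G \<subseteq> Lip11" "G \<noteq> {}" and K: "K \<in> borel \<rightarrow>\<^sub>M prob_algebra borel"
    and \<mu>: "\<mu> \<in> space (prob_algebra borel)" and \<nu>: "prob_space \<nu>"
  shows "ennreal (KR_dist_on G (\<mu> \<bind> K) \<nu>) \<le> (\<integral>\<^sup>+y. ennreal (KR_dist_on G (K y) \<nu>) \<partial>\<mu>)"
proof -
  interpret prob_space \<mu>
    using \<mu> by (simp add: space_prob_algebra)
  have sets_\<mu> [measurable_cong]: "sets \<mu> = sets borel"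
    using \<mu> by (simp add: space_prob_algebra)
  have K_\<mu>: "K \<in> \<mu> \<rightarrow>\<^sub>M prob_algebra borel"
    using K by (simp add: sets_\<mu> cong: measurable_cong_sets)
  note K_sub [measurable] = measurable_prob_algebraD[OF K_\<mu>]
  have pK: "prob_space (K y)" for y
    using measurable_space[OF K, of y] by (simp add: space_prob_algebra)
  let ?k = "\<lambda>y. KR_dist_on G (K y) \<nu>"
  have k_meas [measurable]: "?k \<in> borel_measurable \<mu>"
    by (rule borel_measurable_KR_dist_on[OF G(1,2) K_\<mu> \<nu>])
  have k: "0 \<le> ?k y" "?k y \<le> 2" for y
    using KR_dist_on_bounds[OF G(2,3) pK \<nu>] by auto
  have k_int: "integrable \<mu> ?k"
    using k by (intro integrable_const_bound[of _ 2]) auto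
  have "KR_dist_on G (\<mu> \<bind> K) \<nu> \<le> (\<integral>y. ?k y \<partial>\<mu>)"
  proof (subst KR_dist_on_def, intro cSUP_least G(3))
    fix f assume f: "f \<in> G"
    then have Lip: "f \<in> Lip11"
      using G(2) by blast
    then have f_le: "\<bar>f x\<bar> \<le> 1" for x
      by (simp add: Lip11_def)
    note [measurable] = Lip11_measurable[OF Lip]
    have [measurable]: "(\<lambda>y. \<integral>x. f x \<partial>K y) \<in> borel_measurable \<mu>"
      by (rule measurable_compose[OF K_sub integral_measurable_subprob_algebra]) measurable
    have int: "integrable \<mu> (\<lambda>y. \<integral>x. f x \<partial>K y)"
      by (intro integrable_const_bound[of _ 1]) (auto intro: bounded_integral_le_1 pK f_le)
    have "(\<integral>x. f x \<partial>(\<mu> \<bind> K)) = (\<integral>y. \<integral>x. f x \<partial>K y \<partial>\<mu>)"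
      by (rule integral_bind[where B = 1 and B' = 1 and K = borel])
        (auto simp: f_le prob_space.emeasure_space_1[OF pK] finite_measure_axioms)
    also have "\<bar>\<dots> - (\<integral>x. f x \<partial>\<nu>)\<bar> = \<bar>\<integral>y. (\<integral>x. f x \<partial>K y) - (\<integral>x. f x \<partial>\<nu>) \<partial>\<mu>\<bar>"
      using int by (simp add: prob_space)
    also have "\<dots> \<le> (\<integral>y. \<bar>(\<integral>x. f x \<partial>K y) - (\<integral>x. f x \<partial>\<nu>)\<bar> \<partial>\<mu>)"
      by simp
    also have "\<dots> \<le> (\<integral>y. ?k y \<partial>\<mu>)"
      using int k_int KR_dist_on_upper[OF G(2) pK \<nu> f] by (intro integral_mono) auto
    finally show "\<bar>(\<integral>x. f x \<partial>(\<mu> \<bind> K)) - (\<integral>x. f x \<partial>\<nu>)\<bar> \<le> (\<integral>y. ?k y \<partial>\<mu>)" .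
  qed
  then have "ennreal (KR_dist_on G (\<mu> \<bind> K) \<nu>) \<le> ennreal (\<integral>y. ?k y \<partial>\<mu>)"
    by (rule ennreal_leI)
  also have "\<dots> = (\<integral>\<^sup>+y. ennreal (?k y) \<partial>\<mu>)"
    using k k_int by (intro nn_integral_eq_integral[symmetric]) auto
  finally show ?thesis .
qed

section \<open>Transition kernels and stationarity\<close>

context process_family
begin

lemma law_kernel:
  assumes "0 \<le> t"
  shows "(\<lambda>x. law X P x t) \<in> borel \<rightarrow>\<^sub>M prob_algebra borel"
  unfolding law_def
  using measurable_compose[OF kernel measurable_distr_prob_space[OF measurable_X[OF assms]]] .

lemma law_in_prob_algebra: "0 \<le> t \<Longrightarrow> law X P x t \<in> space (prob_algebra borel)"
  using measurable_space[OF law_kernel, of t x] by simp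

lemma law_prob_space: "0 \<le> t \<Longrightarrow> prob_space (law X P x t)"
  using law_in_prob_algebra[of t x] by (simp add: space_prob_algebra)

text \<open>Stationarity speaks of the path law \<open>\<pi> \<bind> P\<close>; pushing forward
  along \<open>X t\<close> commutes with the mixture and gives invariance under the transition
  kernel.\<close>

lemma stationary_bind_law:
  assumes st: "stationary X P \<pi>" and t: "0 \<le> t"
  shows "\<pi> \<bind> (\<lambda>x. law X P x t) = \<pi>"
proof -
  have \<pi>: "sets \<pi> = sets borel" "prob_space \<pi>"
    using st by (auto simp: stationary_def)
  have "P \<in> \<pi> \<rightarrow>\<^sub>M subprob_algebra \<Omega>"
    using measurable_prob_algebraD[OF kernel] by (simp add: \<pi> cong: measurable_cong_sets)
  then have "distr (\<pi> \<bind> P) borel (X t) = \<pi> \<bind> (\<lambda>x. law X P x t)"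
    unfolding law_def using prob_space.not_empty[OF \<pi>(2)] measurable_X[OF t] by (intro distr_bind)
  then show ?thesis
    using st t by (simp add: stationary_def)
qed

text \<open>By invariance the complement of the closure is null for the mixture of the laws, hence
  null for almost every one of them.\<close>

lemma AE_law_closure:
  assumes st: "stationary X P \<pi>" and t: "0 \<le> t" and S: "AE x in \<pi>. x \<in> closure S"
  shows "AE x in \<pi>. AE y in law X P x t. y \<in> closure S"
proof -
  have \<pi>: "sets \<pi> = sets borel"
    using st by (auto simp: stationary_def)
  have "AE x in \<pi> \<bind> (\<lambda>x. law X P x t). x \<in> closure S"
    using S by (subst stationary_bind_law[OF st t])
  moreover have "(\<lambda>x. law X P x t) \<in> \<pi> \<rightarrow>\<^sub>M subprob_algebra borel"
    using measurable_prob_algebraD[OF law_kernel[OF t]] by (simp add: \<pi> cong: measurable_cong_sets)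
  moreover have "Measurable.pred borel (\<lambda>x. x \<in> closure S)"
    by (intro pred_sets2[of _ borel]) auto
  ultimately show ?thesis
    by (simp add: AE_bind)
qed

text \<open>The integrand may fail to be measurable; it agrees almost everywhere with the measurable
  one on the right, to which Fubini-type and convergence results apply.\<close>

lemma averaged_KR_dist_eq:
  assumes st: "stationary X P \<pi>" and t: "0 \<le> t" and s: "AE x in \<pi>. x \<in> closure (range s)"
  shows "averaged_KR_dist X P \<pi> t = (\<integral>\<^sup>+x. ennreal (KR_dist_on (test_functions s) (law X P x t) \<pi>) \<partial>\<pi>)"
  unfolding averaged_KR_dist_def
proof (rule nn_integral_cong_AE)
  have \<pi>: "\<pi> \<in> space (prob_algebra borel)"
    using st by (simp add: stationary_def space_prob_algebra)
  show "AE x in \<pi>. ennreal (KR_dist (law X P x t) \<pi>) =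
      ennreal (KR_dist_on (test_functions s) (law X P x t) \<pi>)"
    using AE_law_closure[OF st t s] s
    by eventually_elim (simp add: KR_dist_eq_test_functions law_in_prob_algebra \<pi> t s)
qed

end

section \<open>Chapman-Kolmogorov and monotonicity in time\<close>

context homogeneous_markov_process
begin

text \<open>The Chapman-Kolmogorov equation: take expectations in the Markov property. The
  conditional expectation given the past up to \<open>s\<close> integrates to the probability at
  time \<open>s + t\<close>, and the restarted probability depends on the path only through
  \<open>X s\<close>.\<close>

lemma law_add:
  assumes s: "0 \<le> s" and t: "0 \<le> t"
  shows "law X P x (s + t) = law X P x s \<bind> (\<lambda>y. law X P y t)"
proof (rule measure_eqI)
  show sets_eq: "sets (law X P x (s + t)) = sets (law X P x s \<bind> (\<lambda>y. law X P y t))"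
    by (subst sets_bind'[OF law_in_prob_algebra[OF s] law_kernel[OF t]]) (simp add: law_def)
  have Px: "prob_space (P x)" "sets (P x) = sets \<Omega>"
    using measurable_space[OF kernel, of x] by (auto simp: space_prob_algebra)
  interpret Px: prob_space "P x" by fact
  have X [measurable]: "X u \<in> P x \<rightarrow>\<^sub>M borel" if "0 \<le> u" for u
    using measurable_X[OF that] by (simp add: Px(2) cong: measurable_cong_sets)
  have "space (P x) = space \<Omega>"
    using Px(2) by (rule sets_eq_imp_space_eq)
  moreover have "sets (natural_filtration \<Omega> X s) \<subseteq> sets \<Omega>"
  proof -
    let ?gen = "{X u -` A \<inter> space \<Omega> | u A. 0 \<le> u \<and> u \<le> s \<and> A \<in> sets borel}"
    have gen: "?gen \<subseteq> sets \<Omega>"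
      using measurable_sets[OF measurable_X] by auto
    then have "sets (sigma (space \<Omega>) ?gen) = sigma_sets (space \<Omega>) ?gen"
      using sets.space_closed by (intro sets_measure_of) blast
    then show ?thesis
      using sets.sigma_sets_subset[OF gen] by (simp add: natural_filtration_def)
  qed
  ultimately have "subalgebra (P x) (natural_filtration \<Omega> X s)"
    using Px(2) by (simp add: subalgebra_def natural_filtration_def space_measure_of_conv)
  then interpret F: finite_measure_subalgebra "P x" "natural_filtration \<Omega> X s"
    by unfold_locales
  interpret L: prob_space "law X P x s" by (rule law_prob_space[OF s])
  interpret B: prob_space "law X P x s \<bind> (\<lambda>y. law X P y t)"
    by (rule prob_space_bind'[OF law_in_prob_algebra[OF s] law_kernel[OF t]])
  interpret L': prob_space "law X P x (s + t)" using s t by (intro law_prob_space) simp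
  fix A assume "A \<in> sets (law X P x (s + t))"
  then have A [measurable]: "A \<in> sets borel"
    by (simp add: law_def)
  have K: "(\<lambda>y. law X P y t) \<in> law X P x s \<rightarrow>\<^sub>M subprob_algebra borel"
    using measurable_prob_algebraD[OF law_kernel[OF t]] by (simp add: law_def cong: measurable_cong_sets)
  have [measurable]: "(\<lambda>y. measure (law X P y t) A) \<in> borel_measurable borel"
    by (rule measurable_compose[OF law_kernel[OF t] measurable_measure_prob_algebra[OF A]])
  have st: "0 \<le> s + t"
    using s t by simp
  note [measurable] = X[OF s] X[OF st]
  let ?I = "\<lambda>\<omega>. indicator A (X (s + t) \<omega>) :: real"
  have I: "integrable (P x) ?I"
    by (intro Px.integrable_const_bound[of _ 1]) auto
  have "measure (law X P x (s + t)) A = (\<integral>y. indicator A y \<partial>law X P x (s + t))"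
    by (simp add: law_def)
  also have "\<dots> = (\<integral>\<omega>. ?I \<omega> \<partial>P x)"
    unfolding law_def by (rule integral_distr) measurable
  also have "\<dots> = (\<integral>\<omega>. real_cond_exp (P x) (natural_filtration \<Omega> X s) ?I \<omega> \<partial>P x)"
    by (rule F.real_cond_exp_int(2)[OF I, symmetric])
  also have "\<dots> = (\<integral>\<omega>. measure (law X P (X s \<omega>) t) A \<partial>P x)"
    using markov[OF s t A, of x] by (intro integral_cong_AE) measurable
  also have "\<dots> = (\<integral>y. measure (law X P y t) A \<partial>law X P x s)"
    unfolding law_def[of X P x s] by (rule integral_distr[symmetric]) measurable
  also have "\<dots> = measure (law X P x s \<bind> (\<lambda>y. law X P y t)) A"
    by (rule L.measure_bind[OF K A, symmetric])
  finally show "emeasure (law X P x (s + t)) A = emeasure (law X P x s \<bind> (\<lambda>y. law X P y t)) A"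
    by (simp add: L'.emeasure_eq_measure B.emeasure_eq_measure)
qed

text \<open>The excess time \<open>t - T\<close> is run first: convexity moves it out of the
  distance, and invariance of \<open>\<pi>\<close> then absorbs it, leaving the distance at time
  \<open>T\<close>.\<close>

lemma averaged_KR_dist_antimono:
  fixes S :: "nat \<Rightarrow> 'b"
  assumes st: "stationary X P \<pi>" and sep: "AE x in \<pi>. x \<in> closure (range S)"
    and T: "0 \<le> T" "T \<le> t"
  shows "averaged_KR_dist X P \<pi> t \<le> averaged_KR_dist X P \<pi> T"
proof -
  have \<pi>: "sets \<pi> = sets borel" "prob_space \<pi>"
    using st by (auto simp: stationary_def)
  let ?G = "test_functions S"
  note G = countable_test_functions[of S] test_functions_subset[of S] test_functions_nonempty[of S]
  have s: "0 \<le> t - T" and t: "0 \<le> t"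
    using T by auto
  have law_t: "law X P x t = law X P x (t - T) \<bind> (\<lambda>y. law X P y T)" for x
    using law_add[OF s T(1), of x] by simp
  have "averaged_KR_dist X P \<pi> t = (\<integral>\<^sup>+x. ennreal (KR_dist_on ?G (law X P x t) \<pi>) \<partial>\<pi>)"
    by (rule averaged_KR_dist_eq[OF st t sep])
  also have "\<dots> \<le> (\<integral>\<^sup>+x. \<integral>\<^sup>+y. ennreal (KR_dist_on ?G (law X P y T) \<pi>) \<partial>law X P x (t - T) \<partial>\<pi>)"
    unfolding law_t
    by (intro nn_integral_mono KR_dist_on_bind_le G law_kernel T law_in_prob_algebra s \<pi>)
  also have "\<dots> = (\<integral>\<^sup>+y. ennreal (KR_dist_on ?G (law X P y T) \<pi>) \<partial>(\<pi> \<bind> (\<lambda>x. law X P x (t - T))))"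
  proof (rule nn_integral_bind[symmetric])
    show "(\<lambda>y. ennreal (KR_dist_on ?G (law X P y T) \<pi>)) \<in> borel_measurable borel"
      using borel_measurable_KR_dist_on[OF G(1,2) law_kernel[OF T(1)] \<pi>(2)] by measurable
    show "(\<lambda>x. law X P x (t - T)) \<in> \<pi> \<rightarrow>\<^sub>M subprob_algebra borel"
      using measurable_prob_algebraD[OF law_kernel[OF s]] by (simp add: \<pi> cong: measurable_cong_sets)
  qed
  also have "\<dots> = averaged_KR_dist X P \<pi> T"
    by (simp add: stationary_bind_law[OF st s] averaged_KR_dist_eq[OF st T(1) sep])
  finally show ?thesis .
qed

end

section \<open>The uniform convergence theorem\<close>

theorem theorem1:
  fixes \<Omega> :: "nat \<Rightarrow> 'w measure"
    and X :: "nat \<Rightarrow> real \<Rightarrow> 'w \<Rightarrow> 'a :: metric_space"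
    and P :: "nat \<Rightarrow> 'a \<Rightarrow> 'w measure"
    and \<Omega>_inf :: "'v measure"
    and X_inf :: "real \<Rightarrow> 'v \<Rightarrow> 'a"
    and P_inf :: "'a \<Rightarrow> 'v measure"
    and \<pi> :: "'a measure"
  assumes markov: "\<And>d. homogeneous_markov_process (\<Omega> d) (X d) (P d)"
    and limit_process: "process_family \<Omega>_inf X_inf P_inf"
    and weak_limit: "\<And>t x. 0 \<le> t \<Longrightarrow>
          weakly_tendsto (\<lambda>d. law (X d) (P d) x t) (law X_inf P_inf x t) sequentially"
    and stationary: "\<And>d. stationary (X d) (P d) \<pi>"
    and stationary_inf: "stationary X_inf P_inf \<pi>"
    and separable: "separably_supported \<pi>"
    and ergodic: "(\<forall>x. weakly_tendsto (\<lambda>t. law X_inf P_inf x t) \<pi> at_top) \<or>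
                  (\<forall>x. ((\<lambda>t. TV_dist (law X_inf P_inf x t) \<pi>) \<longlongrightarrow> 0) at_top)"
  shows "\<forall>\<epsilon>::real. \<epsilon> > 0 \<longrightarrow>
           (\<exists>D::nat. \<exists>T::real. T \<ge> 0 \<and>
              (\<forall>t d. t \<ge> T \<longrightarrow> d \<ge> D \<longrightarrow> averaged_KR_dist (X d) (P d) \<pi> t < ennreal \<epsilon>))"
proof (intro allI impI)
  fix \<epsilon> :: real assume "\<epsilon> > 0"
  interpret D: homogeneous_markov_process "\<Omega> d" "X d" "P d" for d
    by (rule markov)
  interpret I: process_family \<Omega>_inf X_inf P_inf
    by (rule limit_process)
  have \<pi>: "sets \<pi> = sets borel" "prob_space \<pi>" "\<pi> \<in> space (prob_algebra borel)"
    using stationary_inf by (auto simp: stationary_def space_prob_algebra)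
  interpret prob_space \<pi> by (rule \<pi>(2))
  obtain S where S: "countable S" "AE x in \<pi>. x \<in> closure S"
    using separable by (auto simp: separably_supported_def)
  \<comment> \<open>On a probability space no almost sure statement is false everywhere, so
    \<open>S\<close> has a point and can be enumerated, with repetitions if finite.\<close>
  have "S \<noteq> {}"
    using S(2) AE_False by auto
  define s where "s = from_nat_into S"
  have s: "AE x in \<pi>. x \<in> closure (range s)"
    using S \<open>S \<noteq> {}\<close> by (simp add: s_def range_from_nat_into)
  let ?G = "test_functions s"
  note G = countable_test_functions[of s] test_functions_subset[of s] test_functions_nonempty[of s]
  let ?k = "\<lambda>L x. KR_dist_on ?G (L x) \<pi>"
  have k_meas: "(\<lambda>x. ennreal (?k L x)) \<in> borel_measurable \<pi>"
    if "L \<in> borel \<rightarrow>\<^sub>M prob_algebra borel" for L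
    using borel_measurable_KR_dist_on[OF G(1,2) that \<pi>(2)] by (simp add: \<pi>(1) cong: measurable_cong_sets)
  have k_bounds: "0 \<le> ?k L x" "?k L x \<le> 2"
    if "L \<in> borel \<rightarrow>\<^sub>M prob_algebra borel" for L x
    using measurable_space[OF that, of x] KR_dist_on_bounds[OF G(2,3) _ \<pi>(2), of "L x"]
    by (auto simp: space_prob_algebra)
  \<comment> \<open>Dominated convergence with the constant bound 2, valid because the test
    functions are bounded by 1. It serves twice: for time tending to infinity in the limit process
    and for \<open>d\<close> at a fixed time.\<close>
  have lim: "(\<lambda>n. \<integral>\<^sup>+x. ennreal (?k (L n) x) \<partial>\<pi>) \<longlonglongrightarrow> (\<integral>\<^sup>+x. ennreal (u x) \<partial>\<pi>)"
    if L: "\<And>n. L n \<in> borel \<rightarrow>\<^sub>M prob_algebra borel" and u: "(\<lambda>x. ennreal (u x)) \<in> borel_measurable \<pi>"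
      and conv: "AE x in \<pi>. (\<lambda>n. ?k (L n) x) \<longlonglongrightarrow> u x" for L u
  proof (rule nn_integral_dominated_convergence[where w = "\<lambda>_. 2"])
    show "AE x in \<pi>. (\<lambda>n. ennreal (?k (L n) x)) \<longlonglongrightarrow> ennreal (u x)"
      using conv by eventually_elim (rule tendsto_ennrealI)
    show "AE x in \<pi>. ennreal (?k (L n) x) \<le> 2" for n
      using ennreal_leI[OF k_bounds(2)[OF L]] by simp
    show "(\<integral>\<^sup>+x. 2 \<partial>\<pi>) < \<infinity>"
      by (simp add: emeasure_space_1)
  qed (auto intro: k_meas[OF L] u)

  have ergodic_KR: "((\<lambda>t. KR_dist (law X_inf P_inf x t) \<pi>) \<longlongrightarrow> 0) at_top" for x
    using ergodic
  proof
    assume w: "\<forall>x. weakly_tendsto (\<lambda>t. law X_inf P_inf x t) \<pi> at_top"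
    show ?thesis
    proof (rule weakly_tendsto_imp_KR_dist_tendsto[OF w[rule_format] _ \<pi>(3) s])
      \<comment> \<open>Nothing is known about \<open>X_inf\<close> at negative times.\<close>
      show "eventually (\<lambda>t. law X_inf P_inf x t \<in> space (prob_algebra borel)) at_top"
        using eventually_ge_at_top[of "0::real"] by eventually_elim (rule I.law_in_prob_algebra)
    qed
  next
    assume TV: "\<forall>x. ((\<lambda>t. TV_dist (law X_inf P_inf x t) \<pi>) \<longlongrightarrow> 0) at_top"
    show ?thesis
    proof (rule real_tendsto_sandwich[OF _ _ tendsto_const TV[rule_format]])
      show "eventually (\<lambda>t. 0 \<le> KR_dist (law X_inf P_inf x t) \<pi>) at_top"
        using eventually_ge_at_top[of "0::real"] unfolding KR_dist_eq
      proof eventually_elim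
        case (elim t)
        show ?case
          by (rule KR_dist_on_bounds(1)[OF subset_refl Lip11_nonempty I.law_prob_space[OF elim] \<pi>(2)])
      qed
      show "eventually (\<lambda>t. KR_dist (law X_inf P_inf x t) \<pi> \<le> TV_dist (law X_inf P_inf x t) \<pi>) at_top"
        using eventually_ge_at_top[of "0::real"]
        by eventually_elim (intro KR_dist_le_TV_dist I.law_prob_space \<pi>(2))
    qed
  qed

  have inf_kernel: "(\<lambda>x. law X_inf P_inf x (real n)) \<in> borel \<rightarrow>\<^sub>M prob_algebra borel" for n
    by (intro I.law_kernel) simp
  \<comment> \<open>Integer times suffice, as one good time is wanted and dominated convergence
    concerns sequences.\<close>
  have "(\<lambda>n. \<integral>\<^sup>+x. ennreal (?k (\<lambda>x. law X_inf P_inf x (real n)) x) \<partial>\<pi>) \<longlonglongrightarrow> (\<integral>\<^sup>+x. ennreal 0 \<partial>\<pi>)"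
  proof (rule lim[OF inf_kernel])
    show "AE x in \<pi>. (\<lambda>n. KR_dist_on ?G (law X_inf P_inf x (real n)) \<pi>) \<longlonglongrightarrow> 0"
    proof (rule AE_I2)
      fix x
      have "KR_dist_on ?G (law X_inf P_inf x (real n)) \<pi> \<le> KR_dist (law X_inf P_inf x (real n)) \<pi>" for n
        unfolding KR_dist_eq by (intro KR_dist_on_mono G subset_refl I.law_prob_space \<pi>(2)) simp
      then show "(\<lambda>n. KR_dist_on ?G (law X_inf P_inf x (real n)) \<pi>) \<longlonglongrightarrow> 0"
        by (intro real_tendsto_sandwich[OF _ _ tendsto_const
              filterlim_compose[OF ergodic_KR filterlim_real_sequentially]] always_eventually allI
            k_bounds(1)[OF inf_kernel])
    qed
  qed simp
  then have "eventually (\<lambda>n. (\<integral>\<^sup>+x. ennreal (?k (\<lambda>x. law X_inf P_inf x (real n)) x) \<partial>\<pi>) < ennreal \<epsilon>) sequentially"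
    using \<open>\<epsilon> > 0\<close> by (intro order_tendstoD) auto
  then obtain N where N: "(\<integral>\<^sup>+x. ennreal (?k (\<lambda>x. law X_inf P_inf x (real N)) x) \<partial>\<pi>) < ennreal \<epsilon>"
    by (auto simp: eventually_sequentially)

  let ?T = "real N"
  have T: "0 \<le> ?T" by simp
  have "(\<lambda>d. \<integral>\<^sup>+x. ennreal (?k (\<lambda>x. law (X d) (P d) x ?T) x) \<partial>\<pi>) \<longlonglongrightarrow>
      (\<integral>\<^sup>+x. ennreal (?k (\<lambda>x. law X_inf P_inf x ?T) x) \<partial>\<pi>)"
  proof (rule lim[OF D.law_kernel[OF T] k_meas[OF inf_kernel]])
    \<comment> \<open>Stationarity of the limit process makes its law at time \<open>?T\<close>
      separably supported for almost every starting point, so that weak convergence in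
      \<open>d\<close> upgrades to \<open>KR_dist\<close>.\<close>
    show "AE x in \<pi>. (\<lambda>d. KR_dist_on ?G (law (X d) (P d) x ?T) \<pi>) \<longlonglongrightarrow> KR_dist_on ?G (law X_inf P_inf x ?T) \<pi>"
      using I.AE_law_closure[OF stationary_inf T s]
    proof eventually_elim
      case (elim x)
      have "(\<lambda>d. KR_dist (law (X d) (P d) x ?T) (law X_inf P_inf x ?T)) \<longlonglongrightarrow> 0"
        by (rule weakly_tendsto_imp_KR_dist_tendsto[OF weak_limit[OF T] _ I.law_in_prob_algebra[OF T] elim])
          (simp add: D.law_in_prob_algebra)
      then show ?case
        by (rule LIM_zero_cancel[OF Lim_null_comparison, rotated])
          (simp add: KR_dist_on_diff_le[OF G(2,3) D.law_prob_space[OF T] I.law_prob_space[OF T] \<pi>(2)])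
    qed
  qed
  then have "eventually (\<lambda>d. (\<integral>\<^sup>+x. ennreal (?k (\<lambda>x. law (X d) (P d) x ?T) x) \<partial>\<pi>) < ennreal \<epsilon>) sequentially"
    using N by (rule order_tendstoD(2))
  then have "eventually (\<lambda>d. averaged_KR_dist (X d) (P d) \<pi> ?T < ennreal \<epsilon>) sequentially"
    unfolding D.averaged_KR_dist_eq[OF stationary T s] .
  then obtain D where D: "averaged_KR_dist (X d) (P d) \<pi> ?T < ennreal \<epsilon>" if "D \<le> d" for d
    unfolding eventually_sequentially by blast
  \<comment> \<open>\<open>D\<close> was chosen for the single time \<open>?T\<close>; monotonicity
    of each process extends the bound to all later times with the same \<open>D\<close>.\<close>
  have "averaged_KR_dist (X d) (P d) \<pi> t < ennreal \<epsilon>" if "?T \<le> t" "D \<le> d" for t d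
    using D.averaged_KR_dist_antimono[OF stationary s T that(1), of d] D[OF that(2)]
    by (rule order.strict_trans1)
  then show "\<exists>D::nat. \<exists>T::real. T \<ge> 0 \<and>
      (\<forall>t d. t \<ge> T \<longrightarrow> d \<ge> D \<longrightarrow> averaged_KR_dist (X d) (P d) \<pi> t < ennreal \<epsilon>)"
    using T by blast
qed

end
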